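(* Let $(\mathcal A,\psi)$ be an algebra over a field $\Bbbk$, let $D:\mathcal A\to\mathcal A$ be any linear map and let $d$ be a derivation of $(\mathcal A,\psi)$. Then $$\psi'_{D+d}=\psi'_D\qquad\text{and}\qquad \psi''_{D+d}=\psi''_D+\psi'_{[d,D]},$$ where $[d,D]=dD-Dd$.
   Context: An algebra $(\mathcal A,\psi)$ is a $\Bbbk$-vector space $\mathcal A$ (not necessarily finite-dimensional) with an arbitrary bilinear operation $\psi:\mathcal A\times\mathcal A\to\mathcal A$. For a linear map $D:\mathcal A\to\mathcal A$, the derived operation of $\psi$ with respect to $D$ is $$\psi'_D(x,y)=D(\psi(x,y))-\psi(Dx,y)-\psi(x,Dy),$$ and the second derived operation is $\psi''_D=(\psi'_D)'_D$. A derivation is a linear map $d$ with $\psi'_d=0$. *)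

theory Defs
  imports Complex_Main
begin

text \<open>An algebra is a vector space (the whole type \<open>'a\<close>, of arbitrary dimension) with an
  arbitrary bilinear operation: no associativity, commutativity or unit is assumed.\<close>

locale algebra_over = vector_space scale
  for scale :: "'k::field \<Rightarrow> 'a::ab_group_add \<Rightarrow> 'a" +
  fixes \<psi> :: "'a \<Rightarrow> 'a \<Rightarrow> 'a"
  assumes linear_left: "Vector_Spaces.linear scale scale (\<lambda>x. \<psi> x y)"
    and linear_right: "Vector_Spaces.linear scale scale (\<lambda>y. \<psi> x y)"

definition derived_op :: "('a::ab_group_add \<Rightarrow> 'a) \<Rightarrow> ('a \<Rightarrow> 'a \<Rightarrow> 'a) \<Rightarrow> 'a \<Rightarrow> 'a \<Rightarrow> 'a"
  where "derived_op D \<psi> = (\<lambda>x y. D (\<psi> x y) - \<psi> (D x) y - \<psi> x (D y))"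

definition second_derived_op :: "('a::ab_group_add \<Rightarrow> 'a) \<Rightarrow> ('a \<Rightarrow> 'a \<Rightarrow> 'a) \<Rightarrow> 'a \<Rightarrow> 'a \<Rightarrow> 'a"
  where "second_derived_op D \<psi> = derived_op D (derived_op D \<psi>)"

definition derivation ::
    "('k::field \<Rightarrow> 'a::ab_group_add \<Rightarrow> 'a) \<Rightarrow> ('a \<Rightarrow> 'a \<Rightarrow> 'a) \<Rightarrow> ('a \<Rightarrow> 'a) \<Rightarrow> bool"
  where "derivation scale \<psi> d \<longleftrightarrow>
    Vector_Spaces.linear scale scale d \<and> derived_op d \<psi> = (\<lambda>x y. 0)"

definition commutator :: "('a::ab_group_add \<Rightarrow> 'a) \<Rightarrow> ('a \<Rightarrow> 'a) \<Rightarrow> 'a \<Rightarrow> 'a"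
  where "commutator f g = (\<lambda>x. f (g x) - g (f x))"

end

theory Submission
  imports Defs
begin

text \<open>
  Write \<open>D \<cdot> \<psi>\<close> for the derived operation of \<open>\<psi>\<close> with respect to \<open>D\<close>. This is the natural
  action of the Lie algebra of endomorphisms on binary operations: it is additive in \<open>D\<close>
  (\<open>derived_op_plus\<close>), and \<open>d \<cdot> (D \<cdot> \<psi>) - D \<cdot> (d \<cdot> \<psi>) = [d, D] \<cdot> \<psi>\<close>
  (\<open>derived_op_commutator\<close>). A derivation is an element that annihilates \<open>\<psi>\<close>.
  So additivity gives \<open>(D + d) \<cdot> \<psi> = D \<cdot> \<psi>\<close> at once. Applying \<open>D + d\<close> once more gives
  \<open>D \<cdot> (D \<cdot> \<psi>) + d \<cdot> (D \<cdot> \<psi>)\<close>, and in the last term \<open>d\<close> can be moved past \<open>D\<close>, which leaves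
  \<open>[d, D] \<cdot> \<psi>\<close> because \<open>D \<cdot> (d \<cdot> \<psi>) = D \<cdot> 0 = 0\<close>.

  These are identities in the abelian group underlying the algebra, so the lemmas are stated for
  additive maps and biadditive operations.
\<close>

lemma linear_imp_additive:
  assumes "Vector_Spaces.linear s t f"
  shows "additive f"
proof -
  interpret Vector_Spaces.linear s t f by fact
  show ?thesis by unfold_locales (rule add)
qed

lemma derived_op_plus:
  assumes "\<And>y. additive (\<lambda>x. \<psi> x y)" and "\<And>x. additive (\<psi> x)"
  shows "derived_op (\<lambda>x. D x + E x) \<psi> = (\<lambda>x y. derived_op D \<psi> x y + derived_op E \<psi> x y)"
  by (simp add: derived_op_def fun_eq_iff algebra_simps
      additive.add[OF assms(1)] additive.add[OF assms(2)])

lemma derived_op_zero: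
  assumes "additive D"
  shows "derived_op D (\<lambda>x y. 0) = (\<lambda>x y. 0)"
  by (simp add: derived_op_def additive.zero[OF assms])

text \<open>Biadditivity is inherited by the derived operation, so that additivity in the linear map can
  be used a second time, for the operation \<open>derived_op D \<psi>\<close>.\<close>

lemma additive_derived_op_left:
  assumes "\<And>y. additive (\<lambda>x. \<psi> x y)" and "additive D"
  shows "additive (\<lambda>x. derived_op D \<psi> x y)"
  by (rule additive.intro) (simp add: derived_op_def algebra_simps
      additive.add[OF assms(1)] additive.add[OF assms(2)])

lemma additive_derived_op_right:
  assumes "\<And>x. additive (\<psi> x)" and "additive D"
  shows "additive (derived_op D \<psi> x)"
  by (rule additive.intro) (simp add: derived_op_def algebra_simps
      additive.add[OF assms(1)] additive.add[OF assms(2)])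

text \<open>In \<open>derived_op d (derived_op D \<psi>)\<close> the terms in which \<open>d\<close> and \<open>D\<close> act at different places
  (on the value and an argument, or on both arguments) are symmetric in \<open>d\<close> and \<open>D\<close> and cancel
  in the difference. What remains are the terms in which both act at the same place; on an argument
  the order of composition is reversed, which matches the minus sign there.\<close>

lemma derived_op_commutator:
  assumes "\<And>y. additive (\<lambda>x. \<psi> x y)" and "\<And>x. additive (\<psi> x)"
    and "additive D" and "additive d"
  shows "derived_op d (derived_op D \<psi>) x y =
    derived_op D (derived_op d \<psi>) x y + derived_op (commutator d D) \<psi> x y"
  by (simp add: derived_op_def commutator_def algebra_simps
      additive.diff[OF assms(1)] additive.diff[OF assms(2)]
      additive.add[OF assms(3)] additive.add[OF assms(4)]
      additive.diff[OF assms(3)] additive.diff[OF assms(4)])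

theorem proposition3p3:
  fixes scale :: "'k::field \<Rightarrow> 'a::ab_group_add \<Rightarrow> 'a"
    and \<psi> :: "'a \<Rightarrow> 'a \<Rightarrow> 'a"
    and D d :: "'a \<Rightarrow> 'a"
  assumes "algebra_over scale \<psi>"
    and "Vector_Spaces.linear scale scale D"
    and "derivation scale \<psi> d"
  shows "derived_op (\<lambda>x. D x + d x) \<psi> = derived_op D \<psi>
    \<and> second_derived_op (\<lambda>x. D x + d x) \<psi> =
      (\<lambda>x y. second_derived_op D \<psi> x y + derived_op (commutator d D) \<psi> x y)"
proof -
  have \<psi>: "\<And>y. additive (\<lambda>x. \<psi> x y)" "\<And>x. additive (\<psi> x)"
    using algebra_over.linear_left[OF assms(1)] algebra_over.linear_right[OF assms(1)]
    by (blast intro: linear_imp_additive)+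
  have D: "additive D" and d: "additive d"
    using assms(2,3) by (auto simp: derivation_def intro: linear_imp_additive)
  have d_\<psi>: "derived_op d \<psi> = (\<lambda>x y. 0)"
    using assms(3) by (simp add: derivation_def)
  have first: "derived_op (\<lambda>x. D x + d x) \<psi> = derived_op D \<psi>"
    by (simp add: derived_op_plus[OF \<psi>] d_\<psi>)
  have "derived_op d (derived_op D \<psi>) x y = derived_op (commutator d D) \<psi> x y" for x y
    by (simp add: derived_op_commutator[OF \<psi> D d] d_\<psi> derived_op_zero[OF D])
  then have "second_derived_op (\<lambda>x. D x + d x) \<psi> =
      (\<lambda>x y. second_derived_op D \<psi> x y + derived_op (commutator d D) \<psi> x y)"
    by (simp add: second_derived_op_def first
        derived_op_plus[OF additive_derived_op_left[OF \<psi>(1) D] additive_derived_op_right[OF \<psi>(2) D]])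
  with first show ?thesis ..
qed

end
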